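(* Let $R$ be a commutative reduced clean ring which is Hopfian. Then the polynomial ring $R[x]$ in one variable is a Hopfian ring.
   Context: All rings are commutative with a non-zero identity. A ring $R$ is called clean if every element of $R$ can be written as the sum of a unit and an idempotent of $R$. A ring $A$ is called Hopfian if every surjective ring homomorphism $A\to A$ is an automorphism. *)

theory Defs
  imports "HOL-Algebra.Algebra"
begin

definition reduced_ring :: "('a, 'm) ring_scheme \<Rightarrow> bool"
  where "reduced_ring R \<longleftrightarrow>
    (\<forall>x\<in>carrier R. \<forall>n::nat. x [^]\<^bsub>R\<^esub> n = \<zero>\<^bsub>R\<^esub> \<longrightarrow> x = \<zero>\<^bsub>R\<^esub>)"

definition clean_ring :: "('a, 'm) ring_scheme \<Rightarrow> bool"
  where "clean_ring R \<longleftrightarrow>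
    (\<forall>x\<in>carrier R. \<exists>u\<in>Units R. \<exists>e\<in>carrier R. e \<otimes>\<^bsub>R\<^esub> e = e \<and> x = u \<oplus>\<^bsub>R\<^esub> e)"

(* Members of ring_hom preserve the identity; they are constrained on the carrier only,
   hence surjectivity is stated through the image of the carrier. *)
definition hopfian_ring :: "('a, 'm) ring_scheme \<Rightarrow> bool"
  where "hopfian_ring A \<longleftrightarrow>
    (\<forall>h\<in>ring_hom A A. h ` carrier A = carrier A \<longrightarrow> h \<in> ring_iso A A)"

end

theory Submission
  imports Defs
begin

text \<open>
  Over a reduced ring, units and idempotents of \<open>R[x]\<close> are constant, so cleanness forces a
  surjective endomorphism \<open>h\<close> of \<open>R[x]\<close> to restrict to an endomorphism \<open>f\<close> of \<open>R\<close>; hence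
  \<open>h(\<Sum> a\<^sub>i x\<^sup>i) = \<Sum> f(a\<^sub>i) g\<^sup>i\<close> with \<open>g = h(x)\<close>. Write \<open>x = \<Sum> c\<^sub>i g\<^sup>i\<close>. If \<open>g\<close> had
  degree \<open>n \<ge> 2\<close> and leading coefficient \<open>a\<close>, comparing top coefficients repeatedly would show
  that a power of \<open>a\<close> kills all \<open>c\<^sub>i\<close> with \<open>i \<ge> 1\<close>, hence kills \<open>x\<close>, so \<open>a = 0\<close>. Thus \<open>g\<close>
  is linear, and comparing coefficients of \<open>x\<close> shows that its linear coefficient is a unit.
  Then powers of \<open>g\<close> are linearly independent over \<open>R\<close>, which makes \<open>f\<close> surjective, hence
  injective because \<open>R\<close> is Hopfian, and therefore \<open>h\<close> injective.
\<close>

section \<open>Coefficients of products and powers at degree bounds\<close>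

context UP_cring
begin

text \<open>Unqualified, \<open>coeff\<close> and \<open>monom\<close> denote the operations on coefficient lists.\<close>

abbreviation cf :: "(nat \<Rightarrow> 'a) \<Rightarrow> nat \<Rightarrow> 'a"
  where "cf \<equiv> up_ring.coeff P"

text \<open>In the convolution sum only the term \<open>i = m\<close> survives: below it the factor
  from \<open>q\<close> vanishes, above it the one from \<open>p\<close>. Since the bounds need not
  be attained, the lemma iterates even where zero divisors make degrees drop.\<close>

lemma coeff_mult_deg_bounds:
  assumes p: "p \<in> carrier P" "deg R p \<le> m" and q: "q \<in> carrier P" "deg R q \<le> n"
  shows "cf (p \<otimes>\<^bsub>P\<^esub> q) (m + n) = cf p m \<otimes> cf q n"
proof -
  have "cf p i \<otimes> cf q (m + n - i)
      = (if i = m then cf p m \<otimes> cf q n else \<zero>)" if "i \<le> m + n" for i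
  proof (cases i m rule: linorder_cases)
    case less
    then have "deg R q < m + n - i" using q that by linarith
    then show ?thesis using less p q by (simp add: deg_aboveD)
  next
    case greater
    then have "deg R p < i" using p by linarith
    then show ?thesis using greater p q by (simp add: deg_aboveD)
  qed simp
  then have "cf (p \<otimes>\<^bsub>P\<^esub> q) (m + n)
      = (\<Oplus>i\<in>{..m + n}. if m = i then cf p m \<otimes> cf q n else \<zero>)"
    using p q by (auto intro!: R.finsum_cong' simp: eq_commute)
  then show ?thesis
    using p q R.finsum_singleton[of m "{..m + n}" "\<lambda>_. cf p m \<otimes> cf q n"]
    by (simp add: Pi_def)
qed

lemma pow_deg_bound:
  assumes "g \<in> carrier P" "deg R g \<le> n"
  shows "deg R (g [^]\<^bsub>P\<^esub> (k::nat)) \<le> n * k"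
proof (induction k)
  case (Suc k)
  show ?case
    using deg_mult_ring[of "g [^]\<^bsub>P\<^esub> k" g] Suc assms by simp
qed simp

lemma coeff_pow_deg_bound:
  assumes "g \<in> carrier P" "deg R g \<le> n"
  shows "cf (g [^]\<^bsub>P\<^esub> (k::nat)) (n * k) = cf g n [^] k"
proof (induction k)
  case (Suc k)
  show ?case
    using coeff_mult_deg_bounds[of "g [^]\<^bsub>P\<^esub> k" "n * k" g n] Suc assms pow_deg_bound[of g n k]
    by (simp add: add.commute)
qed simp

section \<open>Substitution of a polynomial \<open>g\<close> into polynomials over
  \<open>R\<close>\<close>

definition power_comb :: "(nat \<Rightarrow> 'a) \<Rightarrow> (nat \<Rightarrow> 'a) \<Rightarrow> nat \<Rightarrow> nat \<Rightarrow> 'a"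
  where "power_comb c g k = (\<Oplus>\<^bsub>P\<^esub>i\<in>{..k}. c i \<odot>\<^bsub>P\<^esub> g [^]\<^bsub>P\<^esub> i)"

context
  fixes g :: "nat \<Rightarrow> 'a"
  assumes g: "g \<in> carrier P"
begin

lemma power_comb_0: "(\<And>i. c i \<in> carrier R) \<Longrightarrow> power_comb c g 0 = up_ring.monom P (c 0) 0"
  using g monom_mult_smult[of "c 0" \<one> 0] by (simp add: power_comb_def)

lemma power_comb_Suc:
  assumes "\<And>i. c i \<in> carrier R"
  shows "power_comb c g (Suc k) = c (Suc k) \<odot>\<^bsub>P\<^esub> g [^]\<^bsub>P\<^esub> (Suc k) \<oplus>\<^bsub>P\<^esub> power_comb c g k"
  unfolding power_comb_def
  using g assms by (simp add: P.finsum_Suc Pi_def del: nat_pow_Suc)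

lemma power_comb_closed [simp]:
  assumes "\<And>i. c i \<in> carrier R"
  shows "power_comb c g k \<in> carrier P"
  using g assms by (simp add: power_comb_def Pi_def)

lemma power_comb_smult:
  assumes c: "\<And>i. c i \<in> carrier R" and a: "a \<in> carrier R"
  shows "power_comb (\<lambda>i. a \<otimes> c i) g k = a \<odot>\<^bsub>P\<^esub> power_comb c g k"
proof (induction k)
  case 0
  then show ?case using assms by (simp add: power_comb_0 monom_mult_smult)
next
  case (Suc k)
  then show ?case
    using assms g by (simp add: power_comb_Suc UP_smult_r_distr UP_smult_assoc1 del: nat_pow_Suc)
qed

lemma power_comb_const:
  assumes c: "\<And>i. c i \<in> carrier R" and "\<And>i. 1 \<le> i \<Longrightarrow> i \<le> k \<Longrightarrow> c i = \<zero>"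
  shows "power_comb c g k = up_ring.monom P (c 0) 0"
  using assms(2)
proof (induction k)
  case 0
  then show ?case using c by (simp add: power_comb_0)
next
  case (Suc k)
  then show ?case
    using c g by (simp add: power_comb_Suc del: nat_pow_Suc)
qed

lemma power_comb_deg_bound:
  assumes c: "\<And>i. c i \<in> carrier R" and n: "deg R g \<le> n"
  shows "deg R (power_comb c g k) \<le> n * k"
proof (induction k)
  case 0
  then show ?case using c by (simp add: power_comb_0)
next
  case (Suc k)
  have "deg R (c (Suc k) \<odot>\<^bsub>P\<^esub> g [^]\<^bsub>P\<^esub> Suc k) \<le> n * Suc k"
    using c g pow_deg_bound[OF g n, of "Suc k"] deg_smult_decr[of "c (Suc k)" "g [^]\<^bsub>P\<^esub> Suc k"]
    by (meson P.nat_pow_closed order_trans)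
  then show ?case
    using c g Suc deg_add[of "c (Suc k) \<odot>\<^bsub>P\<^esub> g [^]\<^bsub>P\<^esub> Suc k" "power_comb c g k"]
    by (simp add: power_comb_Suc del: nat_pow_Suc deg_add)
qed

text \<open>As \<open>1 \<le> n\<close>, the lower summands have degree below \<open>n * k\<close>,
  so only the top power contributes.\<close>

lemma coeff_power_comb_deg_bound:
  assumes c: "\<And>i. c i \<in> carrier R" and n: "deg R g \<le> n" "1 \<le> n"
  shows "cf (power_comb c g k) (n * k) = c k \<otimes> cf g n [^] k"
proof (cases k)
  case 0
  then show ?thesis using c by (simp add: power_comb_0)
next
  case (Suc j)
  have "deg R (power_comb c g j) < n * k"
    using power_comb_deg_bound[of c n j] c n Suc by (simp add: le_less_trans)
  then have "cf (power_comb c g j) (n * k) = \<zero>"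
    using c by (simp add: deg_aboveD)
  then show ?thesis
    using c g Suc coeff_pow_deg_bound[OF g n(1), of k]
    by (simp add: power_comb_Suc del: nat_pow_Suc)
qed

text \<open>The chain rule at 0: the linear coefficient of C(g) is C'(g(0)) times that of g. Only
  the divisibility is kept.\<close>

lemma coeff_1_power_comb:
  assumes c: "\<And>i. c i \<in> carrier R"
  shows "\<exists>d\<in>carrier R. cf (power_comb c g k) 1 = cf g 1 \<otimes> d"
proof -
  have pow: "\<exists>d\<in>carrier R. cf (g [^]\<^bsub>P\<^esub> i) 1 = cf g 1 \<otimes> d" for i :: nat
  proof (induction i)
    case 0
    then show ?case by (auto intro!: bexI[of _ \<zero>] simp: g)
  next
    case (Suc i)
    then obtain d where d: "d \<in> carrier R" "cf (g [^]\<^bsub>P\<^esub> i) 1 = cf g 1 \<otimes> d"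
      by blast
    have "{..1::nat} = {0, 1}" by auto
    then have "cf (g [^]\<^bsub>P\<^esub> Suc i) 1
        = cf (g [^]\<^bsub>P\<^esub> i) 0 \<otimes> cf g 1 \<oplus> cf (g [^]\<^bsub>P\<^esub> i) 1 \<otimes> cf g 0"
      using g by (simp add: Pi_def)
    also have "\<dots> = cf g 1 \<otimes> (cf (g [^]\<^bsub>P\<^esub> i) 0 \<oplus> d \<otimes> cf g 0)"
      using g d by (simp add: R.r_distr R.m_ac)
    finally show ?case
      by (rule bexI) (use g d in simp)
  qed
  show ?thesis
  proof (induction k)
    case 0
    then show ?case using c g by (auto intro!: bexI[of _ \<zero>] simp: power_comb_0)
  next
    case (Suc k)
    then obtain d where d: "d \<in> carrier R" "cf (power_comb c g k) 1 = cf g 1 \<otimes> d"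
      by blast
    obtain e where e: "e \<in> carrier R" "cf (g [^]\<^bsub>P\<^esub> Suc k) 1 = cf g 1 \<otimes> e"
      using pow by blast
    have "cf (power_comb c g (Suc k)) 1 = cf g 1 \<otimes> (c (Suc k) \<otimes> e \<oplus> d)"
      using c g d e by (simp add: power_comb_Suc R.r_distr R.m_lcomm del: nat_pow_Suc)
    then show ?case
      by (rule bexI) (use c d e in simp)
  qed
qed

text \<open>The coefficient at \<open>n * k\<close> vanishes because \<open>n * k > 1\<close> for
  positive \<open>k\<close>, so a power of \<open>cf g n\<close> kills \<open>c k\<close>. Rescaling
  all coefficients by it shortens the combination, hence the induction over arbitrary
  \<open>c\<close>.\<close>

lemma power_comb_deg_drop:
  assumes n: "deg R g \<le> n" "2 \<le> n" and c: "\<And>i. c i \<in> carrier R"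
    and "deg R (power_comb c g k) \<le> 1"
  shows "\<exists>N::nat. \<forall>i. 1 \<le> i \<longrightarrow> i \<le> k \<longrightarrow> cf g n [^] N \<otimes> c i = \<zero>"
  using c assms(4)
proof (induction k arbitrary: c)
  case (Suc k)
  define a where "a = cf g n"
  define b where "b = a [^] Suc k"
  have a: "a \<in> carrier R" "b \<in> carrier R" using g by (simp_all add: a_def b_def)
  note cR = Suc.prems(1)
  have "deg R (power_comb c g (Suc k)) < n * Suc k" using Suc.prems(2) n by simp
  then have top: "b \<otimes> c (Suc k) = \<zero>"
    using coeff_power_comb_deg_bound[of c n "Suc k"] cR n deg_aboveD[of "power_comb c g (Suc k)"] a
    by (simp add: a_def b_def R.m_comm del: nat_pow_Suc)
  have "power_comb (\<lambda>i. b \<otimes> c i) g k = power_comb (\<lambda>i. b \<otimes> c i) g (Suc k)"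
    using a cR g top by (simp add: power_comb_Suc del: nat_pow_Suc)
  also have "\<dots> = b \<odot>\<^bsub>P\<^esub> power_comb c g (Suc k)"
    using cR a(2) by (rule power_comb_smult)
  finally have "deg R (power_comb (\<lambda>i. b \<otimes> c i) g k) \<le> 1"
    using deg_smult_decr[OF a(2), of "power_comb c g (Suc k)"] cR Suc.prems(2) by simp
  then obtain N :: nat where
    N: "\<And>i. 1 \<le> i \<Longrightarrow> i \<le> k \<Longrightarrow> a [^] N \<otimes> (b \<otimes> c i) = \<zero>"
    using Suc.IH[of "\<lambda>i. b \<otimes> c i"] a cR unfolding a_def by auto
  \<comment> \<open>The factor \<open>b\<close> alone settles the top index; the lower ones also
    need the \<open>N\<close> factors from the induction hypothesis.\<close>
  have "a [^] (N + Suc k) \<otimes> c i = \<zero>" if "1 \<le> i" "i \<le> Suc k" for i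
  proof -
    have "a [^] (N + Suc k) \<otimes> c i = a [^] N \<otimes> (b \<otimes> c i)"
      unfolding b_def R.nat_pow_mult[OF a(1), symmetric] using a(1) cR by (simp add: R.m_assoc)
    then show ?thesis using N[of i] top that a by (cases "i = Suc k") simp_all
  qed
  then show ?case unfolding a_def by blast
qed auto

text \<open>Uniqueness of expansions in powers of \<open>g\<close>: the coefficient at degree
  \<open>k\<close> is \<open>c k\<close> times a power of a unit, so the \<open>c i\<close> vanish
  from the top down.\<close>

lemma power_comb_linear_const:
  assumes "deg R g \<le> 1" "cf g 1 \<in> Units R" and c: "\<And>i. c i \<in> carrier R"
    and r: "r \<in> carrier R" "power_comb c g k = up_ring.monom P r 0"
  shows "c 0 = r" "\<And>i. 1 \<le> i \<Longrightarrow> i \<le> k \<Longrightarrow> c i = \<zero>"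
proof -
  have "\<forall>i. 1 \<le> i \<longrightarrow> i \<le> k \<longrightarrow> c i = \<zero>"
    using r(2)
  proof (induction k)
    case (Suc k)
    let ?b = "cf g 1"
    have u: "?b [^] Suc k \<in> Units R" using assms(2) by (rule R.Units_pow_closed)
    have "c (Suc k) \<otimes> ?b [^] Suc k = \<zero>"
      using coeff_power_comb_deg_bound[of c 1 "Suc k"] assms(1) c r Suc.prems by simp
    moreover have "c (Suc k) = c (Suc k) \<otimes> ?b [^] Suc k \<otimes> inv (?b [^] Suc k)"
      using u c by (simp add: R.m_assoc R.Units_closed del: nat_pow_Suc)
    ultimately have top: "c (Suc k) = \<zero>"
      using u by (simp del: nat_pow_Suc)
    then have "power_comb c g (Suc k) = power_comb c g k"
      using c g by (simp add: power_comb_Suc del: nat_pow_Suc)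
    then show ?case using Suc top by (metis le_SucE)
  qed auto
  then show *: "\<And>i. 1 \<le> i \<Longrightarrow> i \<le> k \<Longrightarrow> c i = \<zero>" by blast
  have "up_ring.monom P (c 0) 0 = up_ring.monom P r 0"
    using power_comb_const[of c k] c * r by simp
  then show "c 0 = r" using monom_inj[of 0] c r by (auto dest: inj_onD)
qed

end

end

section \<open>Units and idempotents of polynomial rings over reduced rings\<close>

context UP_cring
begin

text \<open>Each multiplication by \<open>cf p n\<close> kills the coefficient of \<open>q\<close>
  at its current degree bound, since the product has no coefficients in positive degree;
  \<open>Suc m\<close> rounds exhaust \<open>q\<close>.\<close>

lemma smult_eq_zero_if_mult_const:
  assumes p: "p \<in> carrier P" "deg R p \<le> n" "1 \<le> n"
    and q: "q \<in> carrier P" "deg R q \<le> m" and "deg R (p \<otimes>\<^bsub>P\<^esub> q) = 0"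
  shows "cf p n [^] Suc m \<odot>\<^bsub>P\<^esub> q = \<zero>\<^bsub>P\<^esub>"
  using q assms(6)
proof (induction m arbitrary: q)
  case 0
  have "cf p n \<otimes> cf q 0 = cf (p \<otimes>\<^bsub>P\<^esub> q) n"
    using coeff_mult_deg_bounds[OF p(1,2) 0(1,2)] by (simp del: coeff_mult)
  also have "\<dots> = \<zero>" using 0 p by (intro deg_aboveD) simp_all
  finally have "cf p n \<otimes> cf q i = \<zero>" for i
    using p 0 by (cases "i = 0") (simp_all add: deg_aboveD)
  then show ?case using p 0 by (intro up_eqI) simp_all
next
  case (Suc m)
  let ?a = "cf p n"
  have "?a \<otimes> cf q (Suc m) = cf (p \<otimes>\<^bsub>P\<^esub> q) (n + Suc m)"
    using coeff_mult_deg_bounds[OF p(1,2) Suc.prems(1,2)] by (simp del: coeff_mult)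
  also have "\<dots> = \<zero>" using Suc.prems p by (intro deg_aboveD) simp_all
  finally have top: "?a \<otimes> cf q (Suc m) = \<zero>" .
  have "cf (?a \<odot>\<^bsub>P\<^esub> q) i = \<zero>" if "m < i" for i
    using that top Suc.prems p by (cases "i = Suc m") (auto simp: deg_aboveD)
  then have deg: "deg R (?a \<odot>\<^bsub>P\<^esub> q) \<le> m"
    using p Suc.prems by (intro deg_aboveI) simp_all
  have "p \<otimes>\<^bsub>P\<^esub> (?a \<odot>\<^bsub>P\<^esub> q) = ?a \<odot>\<^bsub>P\<^esub> (p \<otimes>\<^bsub>P\<^esub> q)"
    using p Suc.prems by (simp add: UP_m_comm[of p] UP_smult_assoc2)
  then have "deg R (p \<otimes>\<^bsub>P\<^esub> (?a \<odot>\<^bsub>P\<^esub> q)) = 0"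
    using deg_smult_decr[of ?a "p \<otimes>\<^bsub>P\<^esub> q"] p Suc.prems by simp
  then have "?a [^] Suc m \<odot>\<^bsub>P\<^esub> (?a \<odot>\<^bsub>P\<^esub> q) = \<zero>\<^bsub>P\<^esub>"
    using Suc.IH[of "?a \<odot>\<^bsub>P\<^esub> q"] deg p Suc.prems by simp
  then show ?case using p Suc.prems by (simp add: UP_smult_assoc1)
qed

context
  assumes reduced: "reduced_ring R"
begin

lemma reducedD: "x \<in> carrier R \<Longrightarrow> x [^] (n::nat) = \<zero> \<Longrightarrow> x = \<zero>"
  using reduced unfolding reduced_ring_def by blast

lemma deg_UP_unit:
  assumes "p \<in> Units P"
  shows "deg R p = 0"
proof (rule ccontr)
  assume nc: "deg R p \<noteq> 0"
  obtain q where pq: "p \<in> carrier P" "q \<in> carrier P" "p \<otimes>\<^bsub>P\<^esub> q = \<one>\<^bsub>P\<^esub>"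
    using assms unfolding Units_def by blast
  define a where "a = cf p (deg R p) [^] Suc (deg R q)"
  have a: "a \<in> carrier R" using pq by (simp add: a_def del: nat_pow_Suc)
  have "a \<odot>\<^bsub>P\<^esub> q = \<zero>\<^bsub>P\<^esub>"
    unfolding a_def using pq nc by (intro smult_eq_zero_if_mult_const) auto
  then have "a \<odot>\<^bsub>P\<^esub> \<one>\<^bsub>P\<^esub> = \<zero>\<^bsub>P\<^esub>"
    using UP_smult_assoc2[OF a pq(2,1)] pq by (simp add: UP_m_comm)
  then have "cf (a \<odot>\<^bsub>P\<^esub> \<one>\<^bsub>P\<^esub>) 0 = \<zero>" by simp
  then have "a = \<zero>" using a by simp
  then have "cf p (deg R p) = \<zero>"
    unfolding a_def using pq by (blast intro: reducedD coeff_closed)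
  then show False using lcoeff_nonzero_deg[OF nc] pq by simp
qed

text \<open>The square of the leading coefficient sits at twice the degree, where \<open>e\<close>
  itself has coefficient zero.\<close>

lemma deg_UP_idempotent:
  assumes e: "e \<in> carrier P" "e \<otimes>\<^bsub>P\<^esub> e = e"
  shows "deg R e = 0"
proof (rule ccontr)
  assume nc: "deg R e \<noteq> 0"
  have "cf e (deg R e) \<otimes> cf e (deg R e) = cf e (deg R e + deg R e)"
    using coeff_mult_deg_bounds[of e "deg R e" e "deg R e"] e by (simp del: coeff_mult)
  also have "\<dots> = \<zero>" using nc e by (intro deg_aboveD) simp_all
  finally have "cf e (deg R e) [^] (2::nat) = \<zero>"
    using e by (simp add: numeral_2_eq_2)
  then have "cf e (deg R e) = \<zero>" using e by (blast intro: reducedD coeff_closed)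
  then show False using lcoeff_nonzero_deg[OF nc] e by simp
qed

lemma power_comb_eq_var:
  assumes g: "g \<in> carrier P" and c: "\<And>i. c i \<in> carrier R"
    and x: "power_comb c g k = up_ring.monom P \<one> 1"
  shows "deg R g \<le> 1" "cf g 1 \<in> Units R"
proof -
  show "deg R g \<le> 1"
  proof (rule ccontr)
    assume nl: "\<not> deg R g \<le> 1"
    define a where "a = cf g (deg R g)"
    have a: "a \<in> carrier R" using g by (simp add: a_def)
    have "deg R (power_comb c g k) \<le> 1" using x deg_monom_le[of \<one> 1] by simp
    then obtain N :: nat where "\<And>i. 1 \<le> i \<Longrightarrow> i \<le> k \<Longrightarrow> a [^] N \<otimes> c i = \<zero>"
      using power_comb_deg_drop[OF g order_refl _ c] nl unfolding a_def by force
    \<comment> \<open>The rescaled combination is a constant, yet it equals \<open>a [^] N\<close>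
      times the variable; its linear coefficient is therefore both zero and
      \<open>a [^] N\<close>.\<close>
    then have "power_comb (\<lambda>i. a [^] N \<otimes> c i) g k = up_ring.monom P (a [^] N \<otimes> c 0) 0"
      using g a c by (intro power_comb_const) auto
    then have "a [^] N \<odot>\<^bsub>P\<^esub> up_ring.monom P \<one> 1 = up_ring.monom P (a [^] N \<otimes> c 0) 0"
      using power_comb_smult[OF g, of c "a [^] N" k] a c x by simp
    then have "cf (a [^] N \<odot>\<^bsub>P\<^esub> up_ring.monom P \<one> 1) 1 = cf (up_ring.monom P (a [^] N \<otimes> c 0) 0) 1"
      by simp
    then have "a [^] N = \<zero>" using a c by simp
    then have "a = \<zero>" using a by (rule reducedD[rotated])
    then show False using lcoeff_nonzero_deg[of g] g nl by (simp add: a_def)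
  qed
  \<comment> \<open>The left side is \<open>\<one>\<close>, so \<open>d\<close> is the inverse of
    \<open>cf g 1\<close>.\<close>
  obtain d where "d \<in> carrier R" "cf (up_ring.monom P \<one> 1) 1 = cf g 1 \<otimes> d"
    using coeff_1_power_comb[OF g, of c k, OF c] x by auto
  then show "cf g 1 \<in> Units R"
    using g R.m_comm[of d "cf g 1"] unfolding Units_def by auto
qed

section \<open>Surjective endomorphisms of the polynomial ring\<close>

lemma hopfian_UP:
  assumes clean: "clean_ring R" and hopf: "hopfian_ring R"
  shows "hopfian_ring P"
  unfolding hopfian_ring_def
proof (intro ballI impI)
  fix h
  assume h: "h \<in> ring_hom P P" and surj: "h ` carrier P = carrier P"
  interpret h: ring_hom_cring P P h
    using h by (intro ring_hom_cringI UP_cring)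
  let ?C = "\<lambda>r. up_ring.monom P r 0"
  \<comment> \<open>Taking the constant coefficient becomes multiplicative only once
    \<open>hC\<close> shows that \<open>h\<close> sends constants to constants.\<close>
  define f where "f r = cf (h (?C r)) 0" for r
  have C_mult: "?C (r \<otimes> s) = ?C r \<otimes>\<^bsub>P\<^esub> ?C s" if "r \<in> carrier R" "s \<in> carrier R" for r s
    using monom_mult[OF that, of 0 0] by simp
  have hC: "h (?C r) = ?C (f r)" if r: "r \<in> carrier R" for r
  proof -
    \<comment> \<open>The images of \<open>u\<close> and \<open>e\<close> are a unit and an
      idempotent of \<open>P\<close>, hence constant, and so is their sum.\<close>
    obtain u e where ue: "u \<in> Units R" "e \<in> carrier R" "e \<otimes> e = e" "r = u \<oplus> e"
      using clean r unfolding clean_ring_def by blast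
    have uR: "u \<in> carrier R" "inv u \<in> carrier R" using ue by auto
    have "h (?C u) \<otimes>\<^bsub>P\<^esub> h (?C (inv u)) = h (?C (u \<otimes> inv u))"
      using uR by (simp only: C_mult monom_closed h.hom_mult)
    also have "\<dots> = \<one>\<^bsub>P\<^esub>" using ue by simp
    finally have "h (?C u) \<in> Units P"
      using uR UP_m_comm[of "h (?C u)" "h (?C (inv u))"] unfolding Units_def
      by (auto intro!: bexI[of _ "h (?C (inv u))"])
    moreover have "h (?C e) \<otimes>\<^bsub>P\<^esub> h (?C e) = h (?C e)"
      using ue by (simp flip: h.hom_mult C_mult)
    ultimately have "deg R (h (?C u)) = 0" "deg R (h (?C e)) = 0"
      using deg_UP_unit deg_UP_idempotent ue by simp_all
    moreover have "h (?C r) = h (?C u) \<oplus>\<^bsub>P\<^esub> h (?C e)"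
      using ue uR by simp
    ultimately have "deg R (h (?C r)) = 0"
      using deg_add[of "h (?C u)" "h (?C e)"] ue uR by simp
    then show ?thesis
      using deg_zero_impl_monom[of "h (?C r)"] r by (simp add: f_def)
  qed
  have fR [simp]: "f r \<in> carrier R" if "r \<in> carrier R" for r
    using that by (simp add: f_def)
  have f_hom: "f \<in> ring_hom R R"
  proof (rule ring_hom_memI)
    fix r s assume rs: "r \<in> carrier R" "s \<in> carrier R"
    have "?C (f (r \<otimes> s)) = ?C (f r \<otimes> f s)"
      using rs hC[of r] hC[of s] hC[of "r \<otimes> s"] C_mult[of r s] C_mult[of "f r" "f s"] by simp
    then show "f (r \<otimes> s) = f r \<otimes> f s"
      using monom_inj[of 0] rs by (auto dest: inj_onD)
    show "f (r \<oplus> s) = f r \<oplus> f s" using rs by (simp add: f_def)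
  qed (simp_all add: f_def)
  define t where "t = up_ring.monom P \<one> 1"
  have t: "t \<in> carrier P" by (simp add: t_def)
  define g where "g = h t"
  have g: "g \<in> carrier P" using t by (simp add: g_def)
  have h_comb: "h (power_comb c t k) = power_comb (\<lambda>i. f (c i)) g k"
    if c: "\<And>i. c i \<in> carrier R" for c k
  proof -
    have "h (c i \<odot>\<^bsub>P\<^esub> t [^]\<^bsub>P\<^esub> i) = h (?C (c i) \<otimes>\<^bsub>P\<^esub> t [^]\<^bsub>P\<^esub> i)" for i
      using c t by (simp add: monom_mult_is_smult)
    also have "\<dots> i = ?C (f (c i)) \<otimes>\<^bsub>P\<^esub> g [^]\<^bsub>P\<^esub> i" for i
      using c t by (simp add: hC g_def)
    also have "\<dots> i = f (c i) \<odot>\<^bsub>P\<^esub> g [^]\<^bsub>P\<^esub> i" for i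
      using c g by (simp add: monom_mult_is_smult)
    finally have "h (c i \<odot>\<^bsub>P\<^esub> t [^]\<^bsub>P\<^esub> i) = f (c i) \<odot>\<^bsub>P\<^esub> g [^]\<^bsub>P\<^esub> i" for i .
    then show ?thesis
      unfolding power_comb_def using c t g by (simp add: h.hom_finsum Pi_def o_def)
  qed
  have h_eq: "h p = power_comb (\<lambda>i. f (cf p i)) g (deg R p)" if p: "p \<in> carrier P" for p
  proof -
    have "up_ring.monom P (cf p i) i = cf p i \<odot>\<^bsub>P\<^esub> t [^]\<^bsub>P\<^esub> i" for i
      using monom_mult_smult[of "cf p i" \<one> i] p monom_pow[of \<one> 1 i] by (simp add: t_def)
    then have "power_comb (cf p) t (deg R p) = p"
      using up_repr[OF p] by (simp add: power_comb_def)
    then show ?thesis using h_comb[of "cf p" "deg R p"] p by simp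
  qed
  \<comment> \<open>A preimage of the variable expresses it in powers of \<open>g\<close>, with
    coefficients \<open>f (cf p i)\<close>.\<close>
  obtain p where "p \<in> carrier P" "h p = t" using surj t by (metis imageE)
  then have "deg R g \<le> 1" "cf g 1 \<in> Units R"
    using power_comb_eq_var[of g "\<lambda>i. f (cf p i)" "deg R p"] h_eq[of p] g by (simp_all add: t_def)
  note lin = power_comb_linear_const[OF g this]
  have "f ` carrier R = carrier R"
  proof (intro equalityI subsetI)
    fix r assume r: "r \<in> carrier R"
    \<comment> \<open>By uniqueness of the expansion of \<open>h q\<close>, the constant coefficient
      of \<open>q\<close> is a preimage of \<open>r\<close> under \<open>f\<close>.\<close>
    then obtain q where q: "q \<in> carrier P" "h q = ?C r" using surj by (metis imageE monom_closed)
    then have "f (cf q 0) = r"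
      using lin(1)[of "\<lambda>i. f (cf q i)" r] h_eq r by simp
    then show "r \<in> f ` carrier R" using q by auto
  qed auto
  then have f_inj: "inj_on f (carrier R)"
    using hopf f_hom unfolding hopfian_ring_def ring_iso_def bij_betw_def by blast
  interpret f: ring_hom_cring R R f
    using f_hom R.cring_axioms by (intro ring_hom_cringI)
  have "q = \<zero>\<^bsub>P\<^esub>" if q: "q \<in> carrier P" "h q = \<zero>\<^bsub>P\<^esub>" for q
  proof (rule up_eqI)
    fix i
    \<comment> \<open>Zero is read as a constant so that uniqueness applies with
      \<open>r = \<zero>\<close>; injectivity of \<open>f\<close> then kills the coefficients of
      \<open>q\<close>.\<close>
    have "power_comb (\<lambda>i. f (cf q i)) g (deg R q) = ?C \<zero>"
      using h_eq q by simp
    then have "f (cf q i) = \<zero>" if "i \<le> deg R q"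
      using lin(1)[of "\<lambda>i. f (cf q i)" \<zero> "deg R q"]
        lin(2)[of "\<lambda>i. f (cf q i)" \<zero> "deg R q" i] q that by (cases "i = 0") auto
    then have "cf q i = \<zero>" if "i \<le> deg R q"
      using that f_inj q f.hom_zero by (metis R.zero_closed coeff_closed inj_onD)
    then show "cf q i = cf \<zero>\<^bsub>P\<^esub> i"
      using q by (cases "i \<le> deg R q") (simp_all add: deg_aboveD)
  qed (use q in simp_all)
  then have "a_kernel P P h = {\<zero>\<^bsub>P\<^esub>}"
    using h.hom_zero UP_zero_closed unfolding a_kernel_def' by blast
  then have "inj_on h (carrier P)"
    by (rule h.ring.trivial_ker_imp_inj)
  then show "h \<in> ring_iso P P"
    using h surj by (simp add: ring_iso_def bij_betw_def)
qed

end

end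

theorem theorem3p8:
  fixes R :: "('a, 'm) ring_scheme"
  assumes "cring R"
    and "\<one>\<^bsub>R\<^esub> \<noteq> \<zero>\<^bsub>R\<^esub>"
    and "reduced_ring R"
    and "clean_ring R"
    and "hopfian_ring R"
  shows "hopfian_ring (UP R)"
proof -
  interpret UP_cring R "UP R"
    using assms(1) by (simp add: UP_cring_def)
  show ?thesis using assms(3-5) by (rule hopfian_UP)
qed

end
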